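(* Let $X,Y$ be LCTV spaces, $\phi\colon X\times Y\to\overline{\mathbb R}$ a function, $F\colon X\rightrightarrows Y$ a set-valued mapping, and let $\mu(x):=\inf\{\phi(x,y)\mid y\in F(x)\}$ for $x\in X$. Let $x_0\in X$ with $\mu(x_0)\in\mathbb R$ and suppose that the set $F(x_0)$ is compact. If $F$ is upper semicontinuous at $x_0$ and $\phi$ is lower semicontinuous at $(x_0,y)$ for all $y\in F(x_0)$, then $\mu$ is lower semicontinuous at $x_0$.
   Context: LCTV space means real locally convex Hausdorff topological vector space. $\overline{\mathbb R}=\mathbb R\cup\{-\infty\}\cup\{\infty\}$ and $\inf\emptyset=\infty$. A function $f\colon X\to\overline{\mathbb R}$ is lower semicontinuous at $x_0$ if for each real $\lambda<f(x_0)$ there is a neighborhood $V$ of $x_0$ with $\lambda<f(x)$ for all $x\in V$. A set-valued mapping $F\colon X\rightrightarrows Y$ is upper semicontinuous at $x_0$ (with $F(x_0)\ne\emptyset$) if for any open set $V\supset F(x_0)$ there is a neighborhood $U$ of $x_0$ such that $F(U)\subset V$, i.e. $F(x)\subset V$ for all $x\in U$. *)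

theory Defs
  imports "HOL-Analysis.Analysis"
begin

(* The first conjunct of locally_convex_0 is convex C unfolded: the constant convex
   has the sort constraint real_vector, which a class specification does not admit. *)
class lctv_space = real_vector + topological_ab_group_add + t2_space +
  assumes tendsto_scaleR_Pair:
    "LIM p (nhds c \<times>\<^sub>F nhds x). fst p *\<^sub>R snd p :> nhds (c *\<^sub>R x)"
  and locally_convex_0:
    "\<lbrakk>open U; 0 \<in> U\<rbrakk> \<Longrightarrow> \<exists>C.
      (\<forall>x\<in>C. \<forall>y\<in>C. \<forall>u\<ge>0. \<forall>v\<ge>0. u + v = 1 \<longrightarrow> u *\<^sub>R x + v *\<^sub>R y \<in> C) \<and>
      C \<subseteq> U \<and> (\<forall>\<^sub>F x in nhds 0. x \<in> C)"

instance real_normed_vector \<subseteq> lctv_space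
proof
  fix c :: real and x :: 'a
  show "LIM p (nhds c \<times>\<^sub>F nhds x). fst p *\<^sub>R snd p :> nhds (c *\<^sub>R x)"
    by (intro tendsto_scaleR filterlim_fst filterlim_snd)
next
  fix U :: "'a set"
  assume "open U" "0 \<in> U"
  then obtain e where e: "e > 0" "ball 0 e \<subseteq> U"
    using open_contains_ball by blast
  have "\<forall>\<^sub>F x in nhds 0. x \<in> ball (0 :: 'a) e"
    using e by (intro eventually_nhds_in_open) auto
  then show "\<exists>C.
      (\<forall>x\<in>C. \<forall>y\<in>C. \<forall>u\<ge>0. \<forall>v\<ge>0. u + v = 1 \<longrightarrow> u *\<^sub>R x + v *\<^sub>R y \<in> C) \<and>
      C \<subseteq> U \<and> (\<forall>\<^sub>F x in nhds 0. x \<in> C)"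
    using e unfolding convex_def [symmetric] by (intro exI[of _ "ball 0 e"]) auto
qed

lemma locally_convex_nhds_0:
  fixes U :: "'a::lctv_space set"
  assumes "open U" "0 \<in> U"
  shows "\<exists>C. convex C \<and> C \<subseteq> U \<and> (\<forall>\<^sub>F x in nhds 0. x \<in> C)"
  unfolding convex_def using assms by (rule locally_convex_0)

definition lower_semicontinuous_at ::
  "('a::topological_space \<Rightarrow> ereal) \<Rightarrow> 'a \<Rightarrow> bool" where
  "lower_semicontinuous_at f x0 \<longleftrightarrow>
     (\<forall>r::real. ereal r < f x0 \<longrightarrow> (\<forall>\<^sub>F x in nhds x0. ereal r < f x))"

definition upper_semicontinuous_at ::
  "('a::topological_space \<Rightarrow> 'b::topological_space set) \<Rightarrow> 'a \<Rightarrow> bool" where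
  "upper_semicontinuous_at F x0 \<longleftrightarrow>
     F x0 \<noteq> {} \<and> (\<forall>V. open V \<and> F x0 \<subseteq> V \<longrightarrow> (\<forall>\<^sub>F x in nhds x0. F x \<subseteq> V))"

(* The infimum over the empty set is \<infinity>, the top element of ereal. *)
definition marginal_function ::
  "('a \<times> 'b \<Rightarrow> ereal) \<Rightarrow> ('a \<Rightarrow> 'b set) \<Rightarrow> 'a \<Rightarrow> ereal" where
  "marginal_function \<phi> F x = (INF y\<in>F x. \<phi> (x, y))"

end

theory Submission
  imports Defs
begin

text \<open>
  Fix reals \<open>r < s < \<mu> x0\<close>. Lower semicontinuity of \<open>\<phi>\<close> at the points \<open>(x0, y)\<close> with \<open>y \<in> F x0\<close>
  gives \<open>s < \<phi>\<close> near each point of the slice \<open>{x0} \<times> F x0\<close>, and compactness of \<open>F x0\<close> turns these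
  neighbourhoods into a single tube \<open>U \<times> V\<close> around the slice (\<open>eventually_nhds_compact_tube\<close>).
  Upper semicontinuity of \<open>F\<close> says exactly that \<open>F x \<subseteq> V\<close> for \<open>x\<close> near \<open>x0\<close>, so that the infimum
  defining \<open>\<mu> x\<close> only runs over values of \<open>\<phi>\<close> in the tube. Hence \<open>r < s \<le> \<mu> x\<close>; the gap between
  \<open>r\<close> and \<open>s\<close> keeps the inequality strict, as an infimum of values above \<open>s\<close> may equal \<open>s\<close>.
\<close>

text \<open>
  The tube lemma for a property that holds near each point of a compact slice: finitely many of the
  boxes given by the product topology cover the slice, and finitely many neighbourhoods of \<open>x0\<close>
  still intersect in a neighbourhood.
\<close>
lemma eventually_nhds_compact_tube:
  fixes x0 :: "'a::topological_space" and K :: "'b::topological_space set"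
  assumes "compact K"
    and near: "\<And>y. y \<in> K \<Longrightarrow> \<forall>\<^sub>F p in nhds (x0, y). P p"
  obtains V where "open V" "K \<subseteq> V" "\<forall>\<^sub>F x in nhds x0. \<forall>y\<in>V. P (x, y)"
proof -
  have "\<exists>W. open W \<and> y \<in> W \<and> (\<forall>\<^sub>F x in nhds x0. \<forall>z\<in>W. P (x, z))" if "y \<in> K" for y
  proof -
    from near[OF that] obtain S where S: "open S" "(x0, y) \<in> S" "\<And>p. p \<in> S \<Longrightarrow> P p"
      by (auto simp: eventually_nhds)
    obtain U W where UW: "open U" "open W" "x0 \<in> U" "y \<in> W" "U \<times> W \<subseteq> S"
      by (rule open_prod_elim[OF S(1,2)]) auto
    have "\<forall>\<^sub>F x in nhds x0. \<forall>z\<in>W. P (x, z)"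
      using eventually_nhds_in_open[OF UW(1,3)] by eventually_elim (use UW(5) S(3) in blast)
    with UW show ?thesis by blast
  qed
  then obtain W where W: "\<And>y. y \<in> K \<Longrightarrow> open (W y)" "\<And>y. y \<in> K \<Longrightarrow> y \<in> W y"
      "\<And>y. y \<in> K \<Longrightarrow> \<forall>\<^sub>F x in nhds x0. \<forall>z\<in>W y. P (x, z)"
    by metis
  have cover: "K \<subseteq> (\<Union>y\<in>K. W y)"
    using W(2) by blast
  obtain D where D: "D \<subseteq> K" "finite D" "K \<subseteq> (\<Union>y\<in>D. W y)"
    using compactE_image[OF \<open>compact K\<close> W(1) cover] by blast
  have "\<forall>\<^sub>F x in nhds x0. \<forall>y\<in>D. \<forall>z\<in>W y. P (x, z)"
    using D(1,2) W(3) by (intro eventually_ball_finite) auto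
  then have "\<forall>\<^sub>F x in nhds x0. \<forall>z\<in>(\<Union>y\<in>D. W y). P (x, z)"
    by simp
  moreover have "open (\<Union>y\<in>D. W y)"
    using D(1) W(1) by blast
  ultimately show thesis
    using D(3) that by blast
qed

lemma lower_semicontinuous_at_marginal_function:
  fixes \<phi> :: "'a::topological_space \<times> 'b::topological_space \<Rightarrow> ereal"
  assumes "compact (F x0)"
    and usc: "upper_semicontinuous_at F x0"
    and lsc: "\<And>y. y \<in> F x0 \<Longrightarrow> lower_semicontinuous_at \<phi> (x0, y)"
  shows "lower_semicontinuous_at (marginal_function \<phi> F) x0"
  unfolding lower_semicontinuous_at_def
proof (intro allI impI)
  fix r :: real
  assume "ereal r < marginal_function \<phi> F x0"
  then obtain s where s: "ereal r < ereal s" "ereal s < marginal_function \<phi> F x0"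
    using ereal_dense2 by blast
  have "\<forall>\<^sub>F p in nhds (x0, y). ereal s < \<phi> p" if "y \<in> F x0" for y
  proof -
    have "ereal s < \<phi> (x0, y)"
      using s(2) INF_lower[OF that] unfolding marginal_function_def by (rule less_le_trans)
    then show ?thesis
      using lsc[OF that] by (simp add: lower_semicontinuous_at_def)
  qed
  from eventually_nhds_compact_tube[OF \<open>compact (F x0)\<close> this]
  obtain V where V: "open V" "F x0 \<subseteq> V" "\<forall>\<^sub>F x in nhds x0. \<forall>y\<in>V. ereal s < \<phi> (x, y)"
    by blast
  have "\<forall>\<^sub>F x in nhds x0. F x \<subseteq> V"
    using usc V(1,2) by (simp add: upper_semicontinuous_at_def)
  with V(3) show "\<forall>\<^sub>F x in nhds x0. ereal r < marginal_function \<phi> F x"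
  proof eventually_elim
    case (elim x)
    then have "ereal s \<le> marginal_function \<phi> F x"
      unfolding marginal_function_def by (intro INF_greatest) (auto intro: less_imp_le)
    with s(1) show ?case
      by (rule less_le_trans)
  qed
qed

theorem proposition4p7:
  fixes \<phi> :: "'a::lctv_space \<times> 'b::lctv_space \<Rightarrow> ereal"
    and F :: "'a \<Rightarrow> 'b set"
    and x0 :: 'a
  assumes "\<bar>marginal_function \<phi> F x0\<bar> \<noteq> \<infinity>"
    and "compact (F x0)"
    and "upper_semicontinuous_at F x0"
    and "\<And>y. y \<in> F x0 \<Longrightarrow> lower_semicontinuous_at \<phi> (x0, y)"
  shows "lower_semicontinuous_at (marginal_function \<phi> F) x0"
  using assms(2-4) by (rule lower_semicontinuous_at_marginal_function)

end
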